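(* Let $T_1$ be a nonzero contraction and $T_2$ an operator on a Hilbert space $\mathcal{H}$. Suppose $T_1T_2=qT_2T_1$, where $q$ is a complex number with $0<|q|\leq\frac{1}{\|T_1\|}$. Let $U$ on $\mathcal{K}'\supseteq\mathcal{H}$ be the minimal unitary dilation of $T_1$ and let $U_q$ be an operator on $\mathcal{K}\supseteq\mathcal{H}$ such that $qU_q$ is the minimal unitary dilation of $qT_1$. Then there exists a bounded linear operator $S:\mathcal{K}\to\mathcal{K}'$ such that (1) $\|S\|=\|T_2\|$; (2) $US=qSU_q$; and (3) $T_1^nT_2=P_{\mathcal{H}}U^nS|_{\mathcal{H}}$ and $T_2T_1^n=P_{\mathcal{H}}SU_q^n|_{\mathcal{H}}$ for all $n\geq 0$.
   Context: All operators are bounded and linear and act on complex Hilbert spaces. A contraction is an operator of norm at most $1$. $P_{\mathcal{H}}$ denotes the orthogonal projection onto $\mathcal{H}$ (from whichever space containing $\mathcal{H}$ is relevant). The minimal unitary dilation of a contraction $T$ on $\mathcal{H}$ is a unitary $U$ on a Hilbert space $\mathcal{K}$ containing $\mathcal{H}$ as a closed subspace such that $T^n=P_{\mathcal{H}}U^n|_{\mathcal{H}}$ for all $n\geq 0$ and $\mathcal{K}$ is the closed linear span of $\{U^nh : h\in\mathcal{H},\ n\in\mathbb{Z}\}$; it is unique up to isomorphism. *)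

theory Defs
  imports "HOL-Analysis.Analysis"
begin

section \<open>Complex Hilbert spaces\<close>

text \<open>The libraries only have real inner product spaces. A complex inner product space is one of
  these with a compatible complex structure: multiplication by real scalars is inherited from
  \<^class>\<open>real_vector\<close>, and the real part of the complex inner product is the real inner
  product of \<^class>\<open>real_inner\<close>, so that the norm, metric and topology are those of the
  complex inner product. The inner product is linear in its first argument.\<close>

class scaleC =
  fixes scaleC :: "complex \<Rightarrow> 'a \<Rightarrow> 'a" (infixr "*\<^sub>C" 75)

class complex_vector = scaleC + real_vector +
  assumes scaleC_add_right: "a *\<^sub>C (x + y) = a *\<^sub>C x + a *\<^sub>C y"
    and scaleC_add_left: "(a + b) *\<^sub>C x = a *\<^sub>C x + b *\<^sub>C x"
    and scaleC_scaleC: "a *\<^sub>C b *\<^sub>C x = (a * b) *\<^sub>C x"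
    and scaleR_scaleC: "r *\<^sub>R x = complex_of_real r *\<^sub>C x"

class complex_inner = complex_vector + real_inner +
  fixes cinner :: "'a \<Rightarrow> 'a \<Rightarrow> complex"
  assumes cinner_commute: "cinner x y = cnj (cinner y x)"
    and cinner_add_left: "cinner (x + y) z = cinner x z + cinner y z"
    and cinner_scaleC_left: "cinner (a *\<^sub>C x) y = a * cinner x y"
    and inner_eq_Re_cinner: "inner x y = Re (cinner x y)"

class chilbert_space = complex_inner + complete_space

lemma cinner_self: "cinner x x = complex_of_real ((norm x)\<^sup>2)" for x :: "'a::complex_inner"
proof (rule complex_eqI)
  show "Re (cinner x x) = Re (complex_of_real ((norm x)\<^sup>2))"
    by (simp add: inner_eq_Re_cinner [symmetric] power2_norm_eq_inner)
  have "Im (cinner x x) = - Im (cinner x x)"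
    by (subst (1) cinner_commute) simp
  then show "Im (cinner x x) = Im (complex_of_real ((norm x)\<^sup>2))"
    by simp
qed

instantiation complex :: chilbert_space
begin

definition scaleC_complex :: "complex \<Rightarrow> complex \<Rightarrow> complex"
  where "scaleC_complex a x = a * x"

definition cinner_complex :: "complex \<Rightarrow> complex \<Rightarrow> complex"
  where "cinner_complex x y = x * cnj y"

instance
  by standard
    (auto simp: scaleC_complex_def cinner_complex_def scaleR_conv_of_real inner_complex_def
      algebra_simps)

end

lemma module_scaleC: "module (scaleC :: complex \<Rightarrow> 'a \<Rightarrow> 'a::complex_vector)"
proof
  fix x :: 'a
  show "1 *\<^sub>C x = x"
    using scaleR_scaleC [of 1 x] by simp
qed (simp_all add: scaleC_add_right scaleC_add_left scaleC_scaleC)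

abbreviation cspan :: "'a::complex_vector set \<Rightarrow> 'a set"
  where "cspan \<equiv> module.span scaleC"

section \<open>Operators\<close>

text \<open>The operator norm of a bounded complex linear operator is \<^const>\<open>onorm\<close>, which
  does not depend on the scalar field.\<close>

definition bounded_clinear :: "('a::complex_inner \<Rightarrow> 'b::complex_inner) \<Rightarrow> bool"
  where "bounded_clinear f \<longleftrightarrow> bounded_linear f \<and> (\<forall>a x. f (a *\<^sub>C x) = a *\<^sub>C f x)"

definition contraction :: "('a::complex_inner \<Rightarrow> 'b::complex_inner) \<Rightarrow> bool"
  where "contraction f \<longleftrightarrow> bounded_clinear f \<and> onorm f \<le> 1"

definition unitary :: "('a::complex_inner \<Rightarrow> 'a) \<Rightarrow> bool"
  where "unitary U \<longleftrightarrow>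
    bounded_clinear U \<and> surj U \<and> (\<forall>x y. cinner (U x) (U y) = cinner x y)"

text \<open>Integer powers, for bijective \<open>U\<close>.\<close>

definition op_powi :: "('a \<Rightarrow> 'a) \<Rightarrow> int \<Rightarrow> 'a \<Rightarrow> 'a"
  where "op_powi U n = (if n \<ge> 0 then U ^^ nat n else inv U ^^ nat (- n))"

text \<open>The orthogonal projection onto a closed subspace \<open>M\<close> of a Hilbert space.\<close>

definition orth_proj :: "'a::complex_inner set \<Rightarrow> 'a \<Rightarrow> 'a"
  where "orth_proj M x = (THE y. y \<in> M \<and> (\<forall>z\<in>M. cinner (x - y) z = 0))"

text \<open>An inclusion of a Hilbert space \<open>H\<close> as a closed subspace of a Hilbert space \<open>K\<close> is
  given by a linear isometry \<open>J\<close> of \<open>H\<close> into \<open>K\<close>, which identifies \<open>H\<close> with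
  \<open>range J\<close>.\<close>

definition isometric_embedding :: "('h::complex_inner \<Rightarrow> 'k::complex_inner) \<Rightarrow> bool"
  where "isometric_embedding J \<longleftrightarrow>
    bounded_clinear J \<and> (\<forall>x y. cinner (J x) (J y) = cinner x y)"

definition minimal_unitary_dilation ::
    "('h::chilbert_space \<Rightarrow> 'k::chilbert_space) \<Rightarrow> ('h \<Rightarrow> 'h) \<Rightarrow> ('k \<Rightarrow> 'k) \<Rightarrow> bool"
  where "minimal_unitary_dilation J T U \<longleftrightarrow>
    isometric_embedding J \<and>
    unitary U \<and>
    (\<forall>n h. J ((T ^^ n) h) = orth_proj (range J) ((U ^^ n) (J h))) \<and>
    closure (cspan {op_powi U n (J h) | n h. True}) = UNIV"

end

theory Submission
  imports Defs
begin

text \<open>Put \<open>W = q U\<^sub>q\<close>, the minimal unitary dilation of the contraction \<open>B = q T\<^sub>1\<close>. The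
  relation between the two operators reads \<open>T\<^sub>1 T\<^sub>2 = T\<^sub>2 B\<close>: \<open>T\<^sub>2\<close> intertwines two
  contractions, and the theorem is the commutant lifting theorem for their unitary dilations
  (\<open>intertwining_lifting\<close>), because \<open>U S = S W\<close> is the same as \<open>U S = q S U\<^sub>q\<close> and the powers of
  \<open>W\<close> and \<open>U\<^sub>q\<close> differ by powers of \<open>q\<close>.

  Commutant lifting is proved as follows, for \<open>A X = X B\<close> with dilations \<open>U\<close> of \<open>A\<close> and \<open>W\<close> of
  \<open>B\<close>; write \<open>J'\<close>, \<open>J\<close> for the embeddings and \<open>J\<^sup>*\<close> for the adjoint. Start with
  \<open>H\<^sub>0 = J' X J\<^sup>*\<close>. Let \<open>M\<close> be the vectors on which \<open>J\<^sup>*\<close> turns \<open>W\<close> into \<open>B\<close> (they contain all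
  \<open>W\<^sup>n J h\<close> with \<open>n \<ge> 0\<close>), and let \<open>N\<close> be the vectors that do not distinguish
  \<open>U\<^sup>j\<^sup>+\<^sup>1 J' h\<close> from \<open>U\<^sup>j J' A h\<close>; \<open>N\<close> is a closed subspace that contains the range of \<open>J'\<close> and is
  invariant under the inverse of \<open>U\<close>. On \<open>M\<close> and against \<open>N\<close> the map \<open>H\<^sub>0\<close> already
  intertwines: \<open>\<langle>U H\<^sub>0 k, y\<rangle> = \<langle>H\<^sub>0 W k, y\<rangle>\<close>.

  The restriction to \<open>y \<in> N\<close> is removed by enlarging \<open>N\<close> to \<open>U N\<close>, \<open>U\<^sup>2 N\<close>, \<dots>. One such
  enlargement (\<open>lifting_step\<close>) prescribes the new component of the operator on the subspace
  \<open>W M\<close> only and must extend it to the whole space without increasing the norm. This is the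
  extension problem of Parrott's lemma: the new component \<open>Z\<close> has to satisfy
  \<open>\<parallel>Z x\<parallel>\<^sup>2 \<le> c\<^sup>2 \<parallel>x\<parallel>\<^sup>2 - \<parallel>H x\<parallel>\<^sup>2\<close>, and the right-hand side is the square of a Hilbert
  seminorm, so that \<open>Z\<close> can be taken to vanish on the orthogonal complement of \<open>W M\<close> for that
  seminorm (\<open>extend_dominated\<close>). The operators so obtained converge strongly because their
  successive differences are orthogonal (\<open>lifting_half\<close>). The limit intertwines \<open>W\<close> and \<open>U\<close>
  on \<open>M\<close>; by minimality the backward translates of \<open>M\<close> under \<open>W\<close> are dense, and
  translating back extends the intertwining to the whole space (\<open>extend_intertwiner\<close>).

  Positivity and orthogonality arguments use the real inner product, which is the real part of the
  complex one; for complex subspaces real and complex orthogonality are the same.\<close>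

section \<open>Bounded complex linear maps\<close>

interpretation cvec: module "scaleC :: complex \<Rightarrow> 'a \<Rightarrow> 'a::complex_vector"
  by (rule module_scaleC)

lemma bounded_clinearI:
  fixes f :: "'a::complex_inner \<Rightarrow> 'b::complex_inner"
  assumes "\<And>x y. f (x + y) = f x + f y"
    and "\<And>a x. f (a *\<^sub>C x) = a *\<^sub>C f x"
    and "\<And>x. norm (f x) \<le> c * norm x"
  shows "bounded_clinear f"
  unfolding bounded_clinear_def
proof (intro conjI allI bounded_linear_intro)
  show "norm (f x) \<le> norm x * c" for x
    using assms(3)[of x] by (simp add: mult.commute)
qed (use assms in \<open>auto simp: scaleR_scaleC\<close>)

lemma bounded_clinear_bounded_linear: "bounded_clinear f \<Longrightarrow> bounded_linear f"
  by (simp add: bounded_clinear_def)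

lemma bounded_clinear_add: "bounded_clinear f \<Longrightarrow> f (x + y) = f x + f y"
  by (simp add: bounded_clinear_def linear_simps)

lemma bounded_clinear_diff: "bounded_clinear f \<Longrightarrow> f (x - y) = f x - f y"
  by (simp add: bounded_clinear_def linear_simps)

lemma bounded_clinear_scaleC: "bounded_clinear f \<Longrightarrow> f (a *\<^sub>C x) = a *\<^sub>C f x"
  by (simp add: bounded_clinear_def)

lemma bounded_clinear_zero: "bounded_clinear f \<Longrightarrow> f 0 = 0"
  by (simp add: bounded_clinear_def linear_simps)

lemma bounded_clinear_compose:
  "bounded_clinear f \<Longrightarrow> bounded_clinear g \<Longrightarrow> bounded_clinear (\<lambda>x. f (g x))"
  unfolding bounded_clinear_def by (auto intro: bounded_linear_compose)

lemma bounded_clinear_funpow: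
  fixes f :: "'a::complex_inner \<Rightarrow> 'a"
  shows "bounded_clinear f \<Longrightarrow> bounded_clinear (f ^^ n)"
proof (induction n)
  case 0
  show ?case by (rule bounded_clinearI[where c = 1]) auto
next
  case (Suc n)
  then show ?case using bounded_clinear_compose[of f "f ^^ n"] by (simp add: comp_def)
qed

lemma inner_scaleC_right:
  fixes x y :: "'a::complex_inner"
  shows "inner x (a *\<^sub>C y) = inner (cnj a *\<^sub>C x) y"
  using cinner_commute[of x "a *\<^sub>C y"] cinner_commute[of x y]
  by (simp add: inner_eq_Re_cinner cinner_scaleC_left)

lemma inner_scaleC_both:
  fixes x y :: "'a::complex_inner"
  shows "inner (a *\<^sub>C x) (a *\<^sub>C y) = (cmod a)\<^sup>2 * inner x y"
  by (simp add: inner_scaleC_right scaleC_scaleC complex_norm_square[symmetric] mult.commute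
      flip: scaleR_scaleC of_real_power)

lemma norm_scaleC:
  fixes x :: "'a::complex_inner"
  shows "norm (a *\<^sub>C x) = cmod a * norm x"
proof -
  have "(norm (a *\<^sub>C x))\<^sup>2 = (cmod a * norm x)\<^sup>2"
    by (simp add: power2_norm_eq_inner inner_scaleC_both power_mult_distrib)
  then show ?thesis by (simp add: power2_eq_iff_nonneg)
qed

lemma tendsto_scaleC:
  fixes X :: "nat \<Rightarrow> 'a::complex_inner"
  assumes "X \<longlonglongrightarrow> x"
  shows "(\<lambda>n. a *\<^sub>C X n) \<longlonglongrightarrow> a *\<^sub>C x"
proof -
  have "bounded_clinear (\<lambda>x::'a. a *\<^sub>C x)"
    by (rule bounded_clinearI[of _ "cmod a"])
      (auto simp: scaleC_add_right scaleC_scaleC mult.commute norm_scaleC)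
  from bounded_linear.tendsto[OF bounded_clinear_bounded_linear[OF this] assms] show ?thesis .
qed

lemma bounded_clinear_limit:
  fixes F :: "nat \<Rightarrow> 'a::complex_inner \<Rightarrow> 'b::complex_inner"
  assumes F: "\<And>n. bounded_clinear (F n)"
    and le: "\<And>n x. norm (F n x) \<le> c * norm x"
    and lim: "\<And>x. (\<lambda>n. F n x) \<longlonglongrightarrow> L x"
  shows "bounded_clinear L" and "norm (L x) \<le> c * norm x"
proof -
  show le': "norm (L x) \<le> c * norm x" for x
    using LIMSEQ_le_const2[OF tendsto_norm[OF lim[of x]]] le by blast
  show "bounded_clinear L"
  proof (rule bounded_clinearI[of _ c])
    show "L (x + y) = L x + L y" for x y
      by (rule LIMSEQ_unique[OF lim])
        (use tendsto_add[OF lim[of x] lim[of y]] in \<open>simp add: bounded_clinear_add[OF F]\<close>)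
    show "L (a *\<^sub>C x) = a *\<^sub>C L x" for a x
      by (rule LIMSEQ_unique[OF lim])
        (use tendsto_scaleC[OF lim[of x], of a] in \<open>simp add: bounded_clinear_scaleC[OF F]\<close>)
  qed (rule le')
qed

section \<open>Extension of maps dominated by a Hilbert seminorm\<close>

text \<open>For \<open>p = 0\<close> the polynomial in \<open>t\<close> is affine and bounded below, hence constant; otherwise it is
  evaluated at its minimum \<open>t = s / p\<close>.\<close>

lemma quadratic_nonneg_imp_discriminant:
  fixes e p s :: real
  assumes p: "0 \<le> p" and quad: "\<And>t. 0 \<le> e - 2 * t * s + t\<^sup>2 * p"
  shows "s\<^sup>2 \<le> e * p"
proof (cases "p = 0")
  case True
  have "s = 0"
  proof (rule ccontr)
    assume "s \<noteq> 0"
    with quad[of "(e + 1) / (2 * s)"] True show False by (simp add: field_simps)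
  qed
  with True show ?thesis by simp
next
  case False
  with p have "0 < p" by simp
  with quad[of "s / p"] show ?thesis
    by (simp add: field_simps power2_eq_square)
qed

text \<open>The real part of a positive semidefinite Hermitian form. A definition by real values keeps
  the variational arguments elementary; complex homogeneity enters only through the scaling law
  for a common complex factor.\<close>

locale semi_inner_form =
  fixes b :: "'a::complex_vector \<Rightarrow> 'a \<Rightarrow> real"
  assumes sym: "b x y = b y x"
    and add_left: "b (x + y) z = b x z + b y z"
    and scaleR_left: "b (r *\<^sub>R x) z = r * b x z"
    and scaleC_both: "b (a *\<^sub>C x) (a *\<^sub>C y) = (cmod a)\<^sup>2 * b x y"
    and nonneg: "0 \<le> b x x"
begin

lemma diff_left: "b (x - y) z = b x z - b y z"
  using add_left[of x "- 1 *\<^sub>R y" z] scaleR_left[of "-1" y z] by simp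

lemma quadratic: "b (x - t *\<^sub>R y) (x - t *\<^sub>R y) = b x x - 2 * t * b x y + t\<^sup>2 * b y y"
proof -
  have "b (x - t *\<^sub>R y) (x - t *\<^sub>R y) = b x (x - t *\<^sub>R y) - t * b y (x - t *\<^sub>R y)"
    by (simp add: diff_left scaleR_left)
  also have "b x (x - t *\<^sub>R y) = b x x - t * b x y"
    using sym[of x "x - t *\<^sub>R y"] sym[of x y] by (simp add: diff_left scaleR_left)
  also have "b y (x - t *\<^sub>R y) = b x y - t * b y y"
    using sym[of y "x - t *\<^sub>R y"] by (simp add: diff_left scaleR_left)
  finally show ?thesis by (simp add: algebra_simps power2_eq_square)
qed

lemma Cauchy_Schwarz: "\<bar>b x y\<bar> \<le> sqrt (b x x) * sqrt (b y y)"
proof -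
  have "(b x y)\<^sup>2 \<le> b x x * b y y"
    by (rule quadratic_nonneg_imp_discriminant) (auto simp: nonneg simp flip: quadratic)
  then have "sqrt ((b x y)\<^sup>2) \<le> sqrt (b x x * b y y)"
    by (rule real_sqrt_le_mono)
  then show ?thesis by (simp add: real_sqrt_mult)
qed

text \<open>The form need not be definite or complete, so a subspace may have no orthogonal projection.
  Orthogonality up to an error \<open>e\<close>, uniformly on \<open>M\<close>, is the substitute: it is linear in \<open>u\<close>,
  it can be reached by subtracting an element of \<open>M\<close> from any given vector, and it forces
  elements of \<open>M\<close> itself to be small.\<close>

definition nearly_orth :: "'a set \<Rightarrow> real \<Rightarrow> 'a \<Rightarrow> bool"
  where "nearly_orth M e u \<longleftrightarrow> (\<forall>m\<in>M. \<bar>b u m\<bar> \<le> e * sqrt (b m m))"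

lemma nearly_orth_add:
  "nearly_orth M e u \<Longrightarrow> nearly_orth M e' u' \<Longrightarrow> nearly_orth M (e + e') (u + u')"
  unfolding nearly_orth_def add_left distrib_right
  by (meson abs_triangle_ineq add_mono order_trans)

lemma nearly_orth_diff:
  "nearly_orth M e u \<Longrightarrow> nearly_orth M e' u' \<Longrightarrow> nearly_orth M (e + e') (u - u')"
  unfolding nearly_orth_def diff_left distrib_right
  by (meson abs_triangle_ineq4 add_mono order_trans)

lemma nearly_orth_scaleC:
  assumes M: "cvec.subspace M" and u: "nearly_orth M e u"
  shows "nearly_orth M (cmod a * e) (a *\<^sub>C u)"
proof (cases "a = 0")
  case True
  have "b 0 m = 0" for m using scaleR_left[of 0 0 m] by simp
  with True show ?thesis by (simp add: nearly_orth_def)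
next
  case False
  show ?thesis unfolding nearly_orth_def
  proof
    fix m assume "m \<in> M"
    define m' where "m' = inverse a *\<^sub>C m"
    have m': "m' \<in> M" unfolding m'_def by (rule cvec.subspace_scale[OF M \<open>m \<in> M\<close>])
    have m: "m = a *\<^sub>C m'" using False by (simp add: m'_def)
    have "\<bar>b (a *\<^sub>C u) m\<bar> = (cmod a)\<^sup>2 * \<bar>b u m'\<bar>"
      by (simp add: m scaleC_both abs_mult del: scaleC_scaleC)
    also have "\<dots> \<le> (cmod a)\<^sup>2 * (e * sqrt (b m' m'))"
      using u m' by (intro mult_left_mono) (auto simp: nearly_orth_def)
    also have "\<dots> = cmod a * e * sqrt (b m m)"
      by (simp add: m scaleC_both real_sqrt_mult power2_eq_square)
    finally show "\<bar>b (a *\<^sub>C u) m\<bar> \<le> cmod a * e * sqrt (b m m)" .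
  qed
qed

lemma nearly_orth_self:
  assumes "nearly_orth M e u" "u \<in> M" "0 \<le> e"
  shows "sqrt (b u u) \<le> e"
proof (cases "b u u = 0")
  case False
  then have pos: "0 < sqrt (b u u)" using nonneg[of u] by simp
  have "sqrt (b u u) * sqrt (b u u) \<le> e * sqrt (b u u)"
    using assms nonneg[of u] by (auto simp: nearly_orth_def)
  then show ?thesis using pos by (rule mult_right_le_imp_le)
qed (use assms in simp)

text \<open>If \<open>m\<close> comes within \<open>e\<^sup>2\<close> of minimising the form at \<open>x - m\<close>, then moving \<open>m\<close> along a
  line in \<open>M\<close> cannot gain more than \<open>e\<^sup>2\<close>, and the discriminant of the resulting quadratic
  polynomial bounds the form between \<open>x - m\<close> and the direction of the line.\<close>

lemma nearly_orth_exists: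
  assumes M: "cvec.subspace M" and e: "0 < e"
  shows "\<exists>m\<in>M. nearly_orth M e (x - m)"
proof -
  define D where "D = (\<lambda>m. b (x - m) (x - m)) ` M"
  have bdd: "bdd_below D" unfolding D_def by (rule bdd_belowI2[of _ 0]) (rule nonneg)
  have "D \<noteq> {}" unfolding D_def using cvec.subspace_0[OF M] by blast
  then obtain m where m: "m \<in> M" "b (x - m) (x - m) < Inf D + e\<^sup>2"
    using cInf_lessD[of D "Inf D + e\<^sup>2"] e unfolding D_def by auto
  have "\<bar>b (x - m) m'\<bar> \<le> e * sqrt (b m' m')" if m': "m' \<in> M" for m'
  proof -
    have "(b (x - m) m')\<^sup>2 \<le> e\<^sup>2 * b m' m'"
    proof (rule quadratic_nonneg_imp_discriminant[OF nonneg])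
      fix t :: real
      have "m + t *\<^sub>R m' \<in> M"
        using M m m' by (simp add: scaleR_scaleC cvec.subspace_add cvec.subspace_scale)
      then have "Inf D \<le> b (x - (m + t *\<^sub>R m')) (x - (m + t *\<^sub>R m'))"
        unfolding D_def by (intro cInf_lower bdd[unfolded D_def]) blast
      also have "x - (m + t *\<^sub>R m') = x - m - t *\<^sub>R m'" by simp
      finally show "0 \<le> e\<^sup>2 - 2 * t * b (x - m) m' + t\<^sup>2 * b m' m'"
        using m(2) unfolding quadratic by linarith
    qed
    then have "sqrt ((b (x - m) m')\<^sup>2) \<le> sqrt (e\<^sup>2 * b m' m')"
      by (rule real_sqrt_le_mono)
    with e show ?thesis by (simp add: real_sqrt_mult)
  qed
  with m(1) show ?thesis by (auto simp: nearly_orth_def)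
qed

text \<open>The extension is \<open>Z\<^sub>0\<close> composed with the orthogonal projection onto the completion of \<open>M\<close>.
  No completion is formed: nearly orthogonal approximations \<open>f n x \<in> M\<close> of \<open>x\<close> are Cauchy for
  the seminorm, so \<open>Z\<^sub>0 (f n x)\<close> converges in the complete target space. Linearity of
  \<open>Z\<close> and agreement with \<open>Z\<^sub>0\<close> on \<open>M\<close> follow in the same way: the difference in question is the
  limit of \<open>Z\<^sub>0\<close> at nearly orthogonal elements of \<open>M\<close>.\<close>

theorem extend_dominated:
  fixes Z\<^sub>0 :: "'a \<Rightarrow> 'c::chilbert_space"
  assumes M: "cvec.subspace M"
    and add: "\<And>x y. x \<in> M \<Longrightarrow> y \<in> M \<Longrightarrow> Z\<^sub>0 (x + y) = Z\<^sub>0 x + Z\<^sub>0 y"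
    and scale: "\<And>a x. x \<in> M \<Longrightarrow> Z\<^sub>0 (a *\<^sub>C x) = a *\<^sub>C Z\<^sub>0 x"
    and le: "\<And>x. x \<in> M \<Longrightarrow> norm (Z\<^sub>0 x) \<le> sqrt (b x x)"
  obtains Z where "\<And>x y. Z (x + y) = Z x + Z y" "\<And>a x. Z (a *\<^sub>C x) = a *\<^sub>C Z x"
    "\<And>x. x \<in> M \<Longrightarrow> Z x = Z\<^sub>0 x" "\<And>x. norm (Z x) \<le> sqrt (b x x)"
    "\<And>x. Z x \<in> closure (Z\<^sub>0 ` M)"
proof -
  define e where "e n = inverse (real (Suc n))" for n
  have e: "0 < e n" for n by (simp add: e_def)
  have e_lim: "e \<longlonglongrightarrow> 0" unfolding e_def by (rule LIMSEQ_inverse_real_of_nat)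
  define f where "f n x = (SOME m. m \<in> M \<and> nearly_orth M (e n) (x - m))" for n x
  have "f n x \<in> M \<and> nearly_orth M (e n) (x - f n x)" for n x
    unfolding f_def by (rule someI_ex) (use nearly_orth_exists[OF M e] in blast)
  then have fM: "f n x \<in> M" and f: "nearly_orth M (e n) (x - f n x)" for n x
    by auto
  have diff: "Z\<^sub>0 (x - y) = Z\<^sub>0 x - Z\<^sub>0 y" if "x \<in> M" "y \<in> M" for x y
    using add[of "x - y" y] cvec.subspace_diff[OF M] that by simp
  have small: "norm (Z\<^sub>0 u) \<le> d" if "u \<in> M" "nearly_orth M d u" "0 \<le> d" for u d
    using le nearly_orth_self that by (meson order_trans)
  have dist: "norm (Z\<^sub>0 (f m x) - Z\<^sub>0 (f n x)) \<le> e n + e m" for m n x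
  proof -
    have "nearly_orth M (e n + e m) (f m x - f n x)"
      using nearly_orth_diff[OF f[of n x] f[of m x]] by simp
    then show ?thesis
      using small[of "f m x - f n x" "e n + e m"] fM cvec.subspace_diff[OF M] e
      by (simp add: diff less_imp_le)
  qed
  have "Cauchy (\<lambda>n. Z\<^sub>0 (f n x))" for x
  proof (rule CauchyI)
    fix r :: real assume "0 < r"
    then obtain n0 where n0: "\<And>n. n \<ge> n0 \<Longrightarrow> e n < r / 2"
      using order_tendstoD(2)[OF e_lim, of "r / 2"] by (auto simp: eventually_sequentially)
    show "\<exists>n0. \<forall>m\<ge>n0. \<forall>n\<ge>n0. norm (Z\<^sub>0 (f m x) - Z\<^sub>0 (f n x)) < r"
    proof (intro exI[of _ n0] allI impI)
      fix m n assume "n0 \<le> m" "n0 \<le> n"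
      then show "norm (Z\<^sub>0 (f m x) - Z\<^sub>0 (f n x)) < r"
        using dist[of m x n] n0[of m] n0[of n] by simp
    qed
  qed
  then have conv: "convergent (\<lambda>n. Z\<^sub>0 (f n x))" for x
    by (rule Cauchy_convergent)
  define Z where "Z x = lim (\<lambda>n. Z\<^sub>0 (f n x))" for x
  have Z: "(\<lambda>n. Z\<^sub>0 (f n x)) \<longlonglongrightarrow> Z x" for x
    unfolding Z_def using conv by (simp add: convergent_LIMSEQ_iff)
  have null: "L = 0" if "X \<longlonglongrightarrow> L" "\<And>n. norm (X n) \<le> C * e n" for X :: "nat \<Rightarrow> 'c" and L C
  proof -
    have "X \<longlonglongrightarrow> 0"
      by (rule Lim_null_comparison[of _ "\<lambda>n. C * e n"]) (use that tendsto_mult_right_zero[OF e_lim] in auto)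
    with that(1) show ?thesis by (rule LIMSEQ_unique)
  qed
  show ?thesis
  proof (rule that)
    fix x y
    have "(\<lambda>n. Z\<^sub>0 (f n (x + y)) - (Z\<^sub>0 (f n x) + Z\<^sub>0 (f n y))) \<longlonglongrightarrow> Z (x + y) - (Z x + Z y)"
      by (intro tendsto_diff tendsto_add Z)
    moreover have "norm (Z\<^sub>0 (f n (x + y)) - (Z\<^sub>0 (f n x) + Z\<^sub>0 (f n y))) \<le> 3 * e n" for n
    proof -
      have "nearly_orth M (3 * e n) (f n (x + y) - (f n x + f n y))"
        using nearly_orth_diff[OF nearly_orth_add[OF f[of n x] f[of n y]] f[of n "x + y"]]
        by (simp add: algebra_simps)
      from small[OF _ this] show ?thesis
        using e[of n] fM M by (simp add: cvec.subspace_diff cvec.subspace_add diff add)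
    qed
    ultimately have "Z (x + y) - (Z x + Z y) = 0" by (rule null)
    then show "Z (x + y) = Z x + Z y" by simp
  next
    fix a x
    have "(\<lambda>n. Z\<^sub>0 (f n (a *\<^sub>C x)) - a *\<^sub>C Z\<^sub>0 (f n x)) \<longlonglongrightarrow> Z (a *\<^sub>C x) - a *\<^sub>C Z x"
      by (intro tendsto_diff tendsto_scaleC Z)
    moreover have "norm (Z\<^sub>0 (f n (a *\<^sub>C x)) - a *\<^sub>C Z\<^sub>0 (f n x)) \<le> (cmod a + 1) * e n" for n
    proof -
      have "nearly_orth M ((cmod a + 1) * e n) (f n (a *\<^sub>C x) - a *\<^sub>C f n x)"
        using nearly_orth_diff[OF nearly_orth_scaleC[OF M f[of n x], of a] f[of n "a *\<^sub>C x"]]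
        by (simp add: algebra_simps cvec.scale_right_diff_distrib)
      from small[OF _ this] show ?thesis
        using e[of n] fM M by (simp add: cvec.subspace_diff cvec.subspace_scale diff scale)
    qed
    ultimately have "Z (a *\<^sub>C x) - a *\<^sub>C Z x = 0" by (rule null)
    then show "Z (a *\<^sub>C x) = a *\<^sub>C Z x" by simp
  next
    fix x assume x: "x \<in> M"
    have "(\<lambda>n. Z\<^sub>0 x - Z\<^sub>0 (f n x)) \<longlonglongrightarrow> Z\<^sub>0 x - Z x"
      by (intro tendsto_diff tendsto_const Z)
    moreover have "norm (Z\<^sub>0 x - Z\<^sub>0 (f n x)) \<le> 1 * e n" for n
      using small[OF _ f[of n x]] e[of n] fM[of n x] x
      by (simp add: cvec.subspace_diff[OF M] diff)
    ultimately have "Z\<^sub>0 x - Z x = 0" by (rule null)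
    then show "Z x = Z\<^sub>0 x" by simp
  next
    fix x
    have "norm (Z\<^sub>0 (f n x)) \<le> sqrt (b x x) + e n" for n
    proof (cases "b (f n x) (f n x) = 0")
      case True
      then have "norm (Z\<^sub>0 (f n x)) \<le> 0" using le[OF fM, of n x] by simp
      also have "0 \<le> sqrt (b x x) + e n" using nonneg[of x] e[of n] by simp
      finally show ?thesis .
    next
      case False
      \<comment> \<open>Split the form at \<open>(?m, ?m)\<close> along \<open>?m = x - (x - ?m)\<close> and divide by the seminorm of \<open>?m\<close>.\<close>
      let ?m = "f n x"
      have pos: "0 < sqrt (b ?m ?m)" using False nonneg[of ?m] by simp
      have "sqrt (b ?m ?m) * sqrt (b ?m ?m) = b x ?m - b (x - ?m) ?m"
        using nonneg[of ?m] by (simp add: diff_left)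
      also have "\<dots> \<le> sqrt (b x x) * sqrt (b ?m ?m) + e n * sqrt (b ?m ?m)"
        using Cauchy_Schwarz[of x ?m] f[of n x] fM[of n x] unfolding nearly_orth_def
        by (smt (verit))
      finally have "sqrt (b ?m ?m) * sqrt (b ?m ?m) \<le> (sqrt (b x x) + e n) * sqrt (b ?m ?m)"
        by (simp only: distrib_right)
      then have "sqrt (b ?m ?m) \<le> sqrt (b x x) + e n"
        using pos by (rule mult_right_le_imp_le)
      with le[OF fM, of n x] show ?thesis by linarith
    qed
    moreover have "(\<lambda>n. sqrt (b x x) + e n) \<longlonglongrightarrow> sqrt (b x x) + 0"
      by (intro tendsto_add tendsto_const e_lim)
    ultimately show "norm (Z x) \<le> sqrt (b x x)"
      using LIMSEQ_le[OF tendsto_norm[OF Z[of x]]] by auto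
  next
    show "Z x \<in> closure (Z\<^sub>0 ` M)" for x
      unfolding closure_sequential
      by (rule exI[of _ "\<lambda>n. Z\<^sub>0 (f n x)"]) (use Z fM in blast)
  qed
qed

end


lemma semi_inner_form_inner: "semi_inner_form (inner :: 'a::complex_inner \<Rightarrow> 'a \<Rightarrow> real)"
  by unfold_locales (simp_all add: inner_commute inner_add inner_scaleC_both)

text \<open>This is the form of the defect operator \<open>c\<^sup>2 - G\<^sup>*G\<close>; its seminorm is the
  norm of the image under the square root of that operator.\<close>

lemma semi_inner_form_defect:
  fixes G :: "'a::complex_inner \<Rightarrow> 'b::complex_inner"
  assumes G: "bounded_clinear G" and le: "\<And>x. norm (G x) \<le> c * norm x"
  shows "semi_inner_form (\<lambda>x y. c\<^sup>2 * inner x y - inner (G x) (G y))"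
proof
  fix x y z :: 'a and r :: real and a :: complex
  show "c\<^sup>2 * inner x y - inner (G x) (G y) = c\<^sup>2 * inner y x - inner (G y) (G x)"
    by (simp add: inner_commute)
  show "c\<^sup>2 * inner (x + y) z - inner (G (x + y)) (G z) =
      c\<^sup>2 * inner x z - inner (G x) (G z) + (c\<^sup>2 * inner y z - inner (G y) (G z))"
    by (simp add: bounded_clinear_add[OF G] inner_add_left algebra_simps)
  show "c\<^sup>2 * inner (r *\<^sub>R x) z - inner (G (r *\<^sub>R x)) (G z) =
      r * (c\<^sup>2 * inner x z - inner (G x) (G z))"
    using bounded_clinear_bounded_linear[OF G]
    by (simp add: linear_simps algebra_simps)
  show "c\<^sup>2 * inner (a *\<^sub>C x) (a *\<^sub>C y) - inner (G (a *\<^sub>C x)) (G (a *\<^sub>C y)) =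
      (cmod a)\<^sup>2 * (c\<^sup>2 * inner x y - inner (G x) (G y))"
    by (simp add: bounded_clinear_scaleC[OF G] inner_scaleC_both algebra_simps)
  have "(norm (G x))\<^sup>2 \<le> (c * norm x)\<^sup>2" by (rule power_mono[OF le]) simp
  then show "0 \<le> c\<^sup>2 * inner x x - inner (G x) (G x)"
    by (simp add: power_mult_distrib power2_norm_eq_inner)
qed

section \<open>Adjoints of isometries and unitary operators\<close>

text \<open>The vector \<open>m\<close> lies in the kernel of the defect form of \<open>R\<close>, so by the Cauchy--Schwarz
  inequality it is orthogonal to everything for that form.\<close>

lemma inner_contraction_norm_preserved:
  fixes R :: "'a::complex_inner \<Rightarrow> 'b::complex_inner"
  assumes "bounded_clinear R" and "\<And>x. norm (R x) \<le> norm x" and "norm (R m) = norm m"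
  shows "inner (R x) (R m) = inner x m"
proof -
  interpret semi_inner_form "\<lambda>x y. 1\<^sup>2 * inner x y - inner (R x) (R y)"
    by (rule semi_inner_form_defect) (use assms in simp_all)
  have "inner m m - inner (R m) (R m) = 0"
    using assms(3) by (simp flip: power2_norm_eq_inner)
  with Cauchy_Schwarz[of x m] show ?thesis by simp
qed

lemma cinner_eq_0I:
  assumes "\<And>a. inner x (a *\<^sub>C y) = 0"
  shows "cinner x y = 0"
proof (rule complex_eqI)
  have "cinner x (\<i> *\<^sub>C y) = cnj \<i> * cinner x y"
    using cinner_commute[of x "\<i> *\<^sub>C y"] cinner_commute[of x y]
    by (simp add: cinner_scaleC_left)
  then show "Im (cinner x y) = Im 0"
    using assms[of \<i>] by (simp add: inner_eq_Re_cinner)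
  show "Re (cinner x y) = Re 0"
    using assms[of 1] by (simp add: inner_eq_Re_cinner)
qed

lemma isometric_embedding_inner:
  "isometric_embedding J \<Longrightarrow> inner (J x) (J y) = inner x y"
  by (simp add: isometric_embedding_def inner_eq_Re_cinner)

lemma isometric_embedding_norm: "isometric_embedding J \<Longrightarrow> norm (J x) = norm x"
  by (simp add: norm_eq_sqrt_inner isometric_embedding_inner)

lemma isometric_embedding_clinear: "isometric_embedding J \<Longrightarrow> bounded_clinear J"
  by (simp add: isometric_embedding_def)

lemma isometric_embedding_inj:
  assumes J: "isometric_embedding J"
  shows "inj J"
proof (rule injI)
  fix x y assume "J x = J y"
  then have "J (x - y) = 0"
    by (simp add: bounded_clinear_diff[OF isometric_embedding_clinear[OF J]])
  with isometric_embedding_norm[OF J, of "x - y"] show "x = y" by simp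
qed

text \<open>A contractive extension of the inverse of \<open>J\<close> from the range of \<open>J\<close> to the whole space is
  automatically the adjoint of \<open>J\<close>, because it preserves the norms of the vectors in the range. This
  also gives the orthogonal projection onto the range.\<close>

lemma isometric_embedding_adjoint:
  fixes J :: "'h::chilbert_space \<Rightarrow> 'k::complex_inner"
  assumes J: "isometric_embedding J"
  obtains R where "bounded_clinear R" "\<And>h. R (J h) = h" "\<And>x. norm (R x) \<le> norm x"
    "\<And>x h. inner (R x) h = inner x (J h)"
proof -
  note lin = isometric_embedding_clinear[OF J]
  have inv: "inv J (J h) = h" for h
    using isometric_embedding_inj[OF J] by simp
  have inv_add: "inv J (J g + J h) = g + h" for g h
    using inv[of "g + h"] by (simp add: bounded_clinear_add[OF lin])
  have inv_scale: "inv J (a *\<^sub>C J h) = a *\<^sub>C h" for a h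
    using inv[of "a *\<^sub>C h"] by (simp add: bounded_clinear_scaleC[OF lin])
  have sub: "cvec.subspace (range J)"
    unfolding cvec.subspace_def
    by (auto simp: bounded_clinear_add[OF lin, symmetric] bounded_clinear_scaleC[OF lin, symmetric]
        intro: range_eqI[of _ J 0] simp: bounded_clinear_zero[OF lin])
  interpret semi_inner_form "inner :: 'k \<Rightarrow> 'k \<Rightarrow> real"
    by (rule semi_inner_form_inner)
  obtain R where R: "\<And>x y. R (x + y) = R x + R y" "\<And>a x. R (a *\<^sub>C x) = a *\<^sub>C R x"
    "\<And>x. x \<in> range J \<Longrightarrow> R x = inv J x" "\<And>x. norm (R x) \<le> sqrt (inner x x)"
    by (rule extend_dominated[OF sub, of "inv J"])
      (auto simp: inv inv_add inv_scale isometric_embedding_norm[OF J]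
        simp flip: norm_eq_sqrt_inner)
  have RJ: "R (J h) = h" for h using R(3) inv by simp
  have le: "norm (R x) \<le> norm x" for x using R(4) by (simp add: norm_eq_sqrt_inner)
  have lin_R: "bounded_clinear R"
    by (rule bounded_clinearI[where c = 1]) (use R(1,2) le in simp_all)
  have "inner (R x) h = inner x (J h)" for x h
    using inner_contraction_norm_preserved[OF lin_R le, of "J h" x]
    by (simp add: RJ isometric_embedding_norm[OF J])
  with lin_R RJ le show ?thesis by (rule that)
qed

lemma orth_proj_range:
  fixes J :: "'h::chilbert_space \<Rightarrow> 'k::complex_inner"
  assumes J: "isometric_embedding J" and adj: "\<And>x h. inner (R x) h = inner x (J h)"
  shows "orth_proj (range J) x = J (R x)"
proof -
  note lin = isometric_embedding_clinear[OF J]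
  have orth: "inner (x - J (R x)) (J h) = 0" for h
    by (simp add: inner_diff_left isometric_embedding_inner[OF J] adj)
  show ?thesis unfolding orth_proj_def
  proof (rule the_equality)
    have "cinner (x - J (R x)) (J h) = 0" for h
      by (rule cinner_eq_0I) (simp add: orth flip: bounded_clinear_scaleC[OF lin])
    then show "J (R x) \<in> range J \<and> (\<forall>z\<in>range J. cinner (x - J (R x)) z = 0)" by auto
  next
    fix y assume y: "y \<in> range J \<and> (\<forall>z\<in>range J. cinner (x - y) z = 0)"
    then obtain g where g: "y = J g" by blast
    have z: "y - J (R x) = J (g - R x)" by (simp add: g bounded_clinear_diff[OF lin])
    have "inner (x - y) (J (g - R x)) = 0"
      using y by (simp add: inner_eq_Re_cinner)
    with orth[of "g - R x"] have "inner (y - J (R x)) (y - J (R x)) = 0"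
      unfolding z by (simp add: inner_diff_left g bounded_clinear_diff[OF lin])
    then show "y = J (R x)" by simp
  qed
qed

lemma unitary_clinear: "unitary U \<Longrightarrow> bounded_clinear U"
  by (simp add: unitary_def)

lemma unitary_isometric: "unitary U \<Longrightarrow> isometric_embedding U"
  by (simp add: unitary_def isometric_embedding_def)

lemma unitary_apply_inv: "unitary U \<Longrightarrow> U (inv U x) = x"
  by (simp add: unitary_def surj_f_inv_f)

lemma unitary_inv_apply: "unitary U \<Longrightarrow> inv U (U x) = x"
  by (simp add: unitary_isometric isometric_embedding_inj)

lemma unitary_inner_left:
  "unitary U \<Longrightarrow> inner (U x) y = inner x (inv U y)"
  using isometric_embedding_inner[OF unitary_isometric, of U x "inv U y"]
  by (simp add: unitary_apply_inv)

lemma unitary_inv: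
  assumes U: "unitary U"
  shows "unitary (inv U)"
  unfolding unitary_def
proof (intro conjI allI)
  note lin = unitary_clinear[OF U]
  show cinner: "cinner (inv U x) (inv U y) = cinner x y" for x y
  proof -
    have "cinner (U (inv U x)) (U (inv U y)) = cinner (inv U x) (inv U y)"
      using U by (simp add: unitary_def)
    then show ?thesis by (simp add: unitary_apply_inv[OF U])
  qed
  show "surj (inv U)" by (rule surjI) (rule unitary_inv_apply[OF U])
  show "bounded_clinear (inv U)"
  proof (rule bounded_clinearI[where c = 1])
    show "inv U (x + y) = inv U x + inv U y" for x y
      using unitary_inv_apply[OF U, of "inv U x + inv U y"]
      by (simp add: bounded_clinear_add[OF lin] unitary_apply_inv[OF U])
    show "inv U (a *\<^sub>C x) = a *\<^sub>C inv U x" for a x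
      using unitary_inv_apply[OF U, of "a *\<^sub>C inv U x"]
      by (simp add: bounded_clinear_scaleC[OF lin] unitary_apply_inv[OF U])
    show "norm (inv U x) \<le> 1 * norm x" for x
      by (simp add: norm_eq_sqrt_inner inner_eq_Re_cinner cinner)
  qed
qed

lemma unitary_funpow_inner:
  assumes "unitary U"
  shows "inner ((U ^^ n) x) ((U ^^ n) y) = inner x y"
  by (induction n) (simp_all add: isometric_embedding_inner[OF unitary_isometric[OF assms]])

lemma unitary_funpow_norm: "unitary U \<Longrightarrow> norm ((U ^^ n) x) = norm x"
  by (simp add: norm_eq_sqrt_inner unitary_funpow_inner)

section \<open>Intertwining on a half-space\<close>

text \<open>If \<open>H\<close> is thought of as the compression to \<open>N\<close> of an intertwiner \<open>S\<close>, then \<open>H'\<close> is the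
  compression of the inverse of \<open>U\<close> composed with \<open>S\<close>; equivalently, \<open>U H'\<close> compresses \<open>S\<close> to
  the larger space \<open>U N\<close>. Working with \<open>H'\<close> keeps \<open>N\<close> fixed. With \<open>V\<close> the inverse of
  \<open>U\<close>, the component of \<open>H'\<close> in \<open>V N\<close> has to be \<open>V H\<close>, while the component \<open>Z\<close>
  orthogonal to \<open>V N\<close> is known only on \<open>W M\<close>, where \<open>H' W = H\<close> forces \<open>Z\<^sub>0\<close>. By the
  compatibility condition \<open>V H W k\<close> is the projection of \<open>H k\<close> onto \<open>V N\<close>, and Pythagoras
  yields the bound of \<open>Z\<^sub>0\<close> by the defect form of \<open>H\<close>.

  The two properties of \<open>H'\<close> also yield the compatibility condition for \<open>H'\<close>, so that the step can
  be repeated.\<close>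

lemma lifting_step:
  fixes U :: "'l::chilbert_space \<Rightarrow> 'l" and W :: "'k::complex_inner \<Rightarrow> 'k" and H :: "'k \<Rightarrow> 'l"
  assumes U: "unitary U" and W: "unitary W"
    and M: "cvec.subspace M"
    and N: "cvec.subspace N" "closed N" "\<And>y. y \<in> N \<Longrightarrow> inv U y \<in> N"
    and H: "bounded_clinear H" "\<And>x. norm (H x) \<le> c * norm x" "\<And>x. H x \<in> N"
    and compat: "\<And>k y. k \<in> M \<Longrightarrow> y \<in> N \<Longrightarrow> inner (U (H k)) y = inner (H (W k)) y"
  obtains H' where "bounded_clinear H'" "\<And>x. norm (H' x) \<le> c * norm x" "\<And>x. H' x \<in> N"
    "\<And>k. k \<in> M \<Longrightarrow> H' (W k) = H k"
    "\<And>x y. y \<in> N \<Longrightarrow> inner (U (H' x)) y = inner (H x) y"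
proof -
  define V where "V = inv U"
  have V: "unitary V" "bounded_clinear V"
    unfolding V_def using unitary_inv[OF U] unitary_clinear by blast+
  have V_inner: "inner (V x) (V y) = inner x y" for x y
    by (rule isometric_embedding_inner[OF unitary_isometric[OF V(1)]])
  have adj: "inner (U x) y = inner x (V y)" for x y
    unfolding V_def by (rule unitary_inner_left[OF U])
  have VN: "V y \<in> N" if "y \<in> N" for y using N(3) that by (simp add: V_def)
  note W_lin = unitary_clinear[OF W]
  note W_inv = unitary_clinear[OF unitary_inv[OF W]]
  define Z\<^sub>0 where "Z\<^sub>0 x = H (inv W x) - V (H x)" for x
  have Z\<^sub>0_W: "Z\<^sub>0 (W k) = H k - V (H (W k))" for k
    by (simp add: Z\<^sub>0_def unitary_inv_apply[OF W])
  have Z\<^sub>0_add: "Z\<^sub>0 (x + y) = Z\<^sub>0 x + Z\<^sub>0 y" for x y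
    by (simp add: Z\<^sub>0_def bounded_clinear_add H(1) W_inv V(2))
  have Z\<^sub>0_scale: "Z\<^sub>0 (a *\<^sub>C x) = a *\<^sub>C Z\<^sub>0 x" for a x
    by (simp add: Z\<^sub>0_def bounded_clinear_scaleC H(1) W_inv V(2) cvec.scale_right_diff_distrib)
  have sub: "cvec.subspace (W ` M)"
    unfolding cvec.subspace_def
  proof (intro conjI ballI allI)
    show "0 \<in> W ` M"
      using cvec.subspace_0[OF M] bounded_clinear_zero[OF W_lin] by force
    show "x + y \<in> W ` M" if "x \<in> W ` M" "y \<in> W ` M" for x y
      using that cvec.subspace_add[OF M] by (auto simp flip: bounded_clinear_add[OF W_lin])
    show "a *\<^sub>C x \<in> W ` M" if "x \<in> W ` M" for a x
      using that cvec.subspace_scale[OF M] by (auto simp flip: bounded_clinear_scaleC[OF W_lin])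
  qed
  interpret semi_inner_form "\<lambda>x y. c\<^sup>2 * inner x y - inner (H x) (H y)"
    by (rule semi_inner_form_defect[OF H(1,2)])
  have dominated: "norm (Z\<^sub>0 x) \<le> sqrt (c\<^sup>2 * inner x x - inner (H x) (H x))" if x: "x \<in> W ` M" for x
  proof -
    obtain k where k: "k \<in> M" "x = W k" using x by blast
    have cross: "inner (H k) (V (H x)) = inner (H x) (H x)"
      using compat[OF k(1) H(3)[of x]] by (simp add: adj k(2))
    have "(norm (Z\<^sub>0 x))\<^sup>2 = inner (H k) (H k) - 2 * inner (H k) (V (H x)) + inner (V (H x)) (V (H x))"
      unfolding k(2) Z\<^sub>0_W by (simp add: power2_norm_eq_inner inner_diff inner_commute)
    also have "\<dots> = (norm (H k))\<^sup>2 - inner (H x) (H x)"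
      by (simp add: cross V_inner power2_norm_eq_inner)
    also have "(norm (H k))\<^sup>2 \<le> (c * norm k)\<^sup>2" by (rule power_mono[OF H(2)]) simp
    also have "norm k = norm x" by (simp add: k(2) isometric_embedding_norm[OF unitary_isometric[OF W]])
    finally have "(norm (Z\<^sub>0 x))\<^sup>2 \<le> c\<^sup>2 * inner x x - inner (H x) (H x)"
      by (simp add: power_mult_distrib power2_norm_eq_inner)
    then show ?thesis by (rule real_le_rsqrt)
  qed
  obtain Z where Z: "\<And>x y. Z (x + y) = Z x + Z y" "\<And>a x. Z (a *\<^sub>C x) = a *\<^sub>C Z x"
    "\<And>x. x \<in> W ` M \<Longrightarrow> Z x = Z\<^sub>0 x"
    "\<And>x. norm (Z x) \<le> sqrt (c\<^sup>2 * inner x x - inner (H x) (H x))"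
    "\<And>x. Z x \<in> closure (Z\<^sub>0 ` W ` M)"
    using extend_dominated[OF sub Z\<^sub>0_add Z\<^sub>0_scale dominated] by blast
  \<comment> \<open>\<open>L\<close> is the part of \<open>N\<close> orthogonal to \<open>V N\<close>. Being closed, it contains all values of \<open>Z\<close>
    as soon as it contains those of \<open>Z\<^sub>0\<close> on \<open>W M\<close>.\<close>
  define L where "L = N \<inter> (\<Inter>y\<in>N. {z. inner z (V y) = 0})"
  have "closed L" unfolding L_def
    by (intro closed_Int N(2) closed_INT ballI closed_Collect_eq continuous_intros)
  have "Z\<^sub>0 ` W ` M \<subseteq> L"
  proof safe
    fix k assume k: "k \<in> M"
    have "Z\<^sub>0 (W k) \<in> N" unfolding Z\<^sub>0_W by (intro cvec.subspace_diff[OF N(1)] H(3) VN)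
    moreover have "inner (Z\<^sub>0 (W k)) (V y) = 0" if "y \<in> N" for y
      using compat[OF k that] unfolding Z\<^sub>0_W by (simp add: inner_diff_left V_inner adj)
    ultimately show "Z\<^sub>0 (W k) \<in> L" by (simp add: L_def)
  qed
  then have "Z x \<in> L" for x using Z(5) closure_minimal[OF _ \<open>closed L\<close>] by blast
  then have ZN: "Z x \<in> N" and Z_orth: "y \<in> N \<Longrightarrow> inner (Z x) (V y) = 0" for x y
    by (auto simp: L_def)
  define H' where "H' x = V (H x) + Z x" for x
  have le: "norm (H' x) \<le> c * norm x" for x
  proof -
    have c: "0 \<le> c * norm x" using order_trans[OF norm_ge_zero H(2)] .
    have "(norm (H' x))\<^sup>2 = inner (V (H x)) (V (H x)) + 2 * inner (Z x) (V (H x)) + (norm (Z x))\<^sup>2"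
      by (simp add: H'_def power2_norm_eq_inner inner_add inner_commute)
    also have "\<dots> = inner (H x) (H x) + (norm (Z x))\<^sup>2"
      by (simp add: V_inner Z_orth H(3))
    also have "(norm (Z x))\<^sup>2 \<le> c\<^sup>2 * inner x x - inner (H x) (H x)"
      using power_mono[OF Z(4)[of x], of 2] nonneg[of x] by simp
    finally have "(norm (H' x))\<^sup>2 \<le> (c * norm x)\<^sup>2"
      by (simp add: power_mult_distrib power2_norm_eq_inner)
    then show ?thesis using c by (rule power2_le_imp_le)
  qed
  show ?thesis
  proof (rule that)
    show "bounded_clinear H'"
      by (rule bounded_clinearI[OF _ _ le])
        (simp_all add: H'_def Z(1,2) bounded_clinear_add bounded_clinear_scaleC V(2) H(1)
          scaleC_add_right)
    show "H' x \<in> N" for x unfolding H'_def by (intro cvec.subspace_add[OF N(1)] VN H(3) ZN)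
    show "H' (W k) = H k" if "k \<in> M" for k
      using that by (simp add: H'_def Z(3) Z\<^sub>0_W)
    show "inner (U (H' x)) y = inner (H x) y" if "y \<in> N" for x y
      using that by (simp add: adj H'_def inner_add_left V_inner Z_orth)
  qed (rule le)
qed

text \<open>Iterating the step gives \<open>f n\<close> for which \<open>F n = U\<^sup>n (f n)\<close> compresses the desired operator to
  \<open>U\<^sup>n N\<close>. Each \<open>F n\<close> is the compression of the later ones, so \<open>F n x\<close> has orthogonal
  increments; since \<open>\<parallel>F n x\<parallel>\<close> is bounded, the sequence converges.\<close>

lemma lifting_half:
  fixes U :: "'l::chilbert_space \<Rightarrow> 'l" and W :: "'k::complex_inner \<Rightarrow> 'k" and H\<^sub>0 :: "'k \<Rightarrow> 'l"
  assumes U: "unitary U" and W: "unitary W"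
    and M: "cvec.subspace M"
    and N: "cvec.subspace N" "closed N" "\<And>y. y \<in> N \<Longrightarrow> inv U y \<in> N"
    and H\<^sub>0: "bounded_clinear H\<^sub>0" "\<And>x. norm (H\<^sub>0 x) \<le> c * norm x" "\<And>x. H\<^sub>0 x \<in> N"
    and compat: "\<And>k y. k \<in> M \<Longrightarrow> y \<in> N \<Longrightarrow> inner (U (H\<^sub>0 k)) y = inner (H\<^sub>0 (W k)) y"
  obtains S where "bounded_clinear S" "\<And>x. norm (S x) \<le> c * norm x"
    "\<And>k. k \<in> M \<Longrightarrow> U (S k) = S (W k)"
    "\<And>x y. y \<in> N \<Longrightarrow> inner (S x) y = inner (H\<^sub>0 x) y"
proof -
  define P where "P n H \<longleftrightarrow> bounded_clinear H \<and> (\<forall>x. norm (H x) \<le> c * norm x) \<and> (\<forall>x. H x \<in> N) \<and>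
    (\<forall>k\<in>M. \<forall>y\<in>N. inner (U (H k)) y = inner (H (W k)) y) \<and> (n = 0 \<longrightarrow> H = H\<^sub>0)"
    for n :: nat and H
  define Q where "Q H H' \<longleftrightarrow> (\<forall>k\<in>M. H' (W k) = H k) \<and>
    (\<forall>x. \<forall>y\<in>N. inner (U (H' x)) y = inner (H x) y)" for H H' :: "'k \<Rightarrow> 'l"
  have step: "\<exists>H'. P (Suc n) H' \<and> Q H H'" if "P n H" for n H
  proof -
    have H: "bounded_clinear H" "\<And>x. norm (H x) \<le> c * norm x" "\<And>x. H x \<in> N"
      "\<And>k y. k \<in> M \<Longrightarrow> y \<in> N \<Longrightarrow> inner (U (H k)) y = inner (H (W k)) y"
      using that by (auto simp: P_def)
    obtain H' where "bounded_clinear H'" "\<And>x. norm (H' x) \<le> c * norm x" "\<And>x. H' x \<in> N"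
      "\<And>k. k \<in> M \<Longrightarrow> H' (W k) = H k"
      "\<And>x y. y \<in> N \<Longrightarrow> inner (U (H' x)) y = inner (H x) y"
      using lifting_step[OF U W M N H] by blast
    then have "P (Suc n) H' \<and> Q H H'" by (simp add: P_def Q_def)
    then show ?thesis by blast
  qed
  have "P 0 H\<^sub>0" using H\<^sub>0 compat by (simp add: P_def)
  then obtain f where f: "\<And>n. P n (f n)" and fQ: "\<And>n. Q (f n) (f (Suc n))"
    using dependent_nat_choice[of P "\<lambda>_. Q"] step by metis
  have f_lin: "bounded_clinear (f n)" and f_le: "norm (f n x) \<le> c * norm x" and fN: "f n x \<in> N"
    for n x using f[of n] by (auto simp: P_def)
  have f_0: "f 0 = H\<^sub>0" using f[of 0] by (simp add: P_def)
  have f_W: "k \<in> M \<Longrightarrow> f (Suc n) (W k) = f n k" for n k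
    using fQ[of n] by (simp add: Q_def)
  have f_U: "y \<in> N \<Longrightarrow> inner (U (f (Suc n) x)) y = inner (f n x) y" for n x y
    using fQ[of n] by (simp add: Q_def)
  define F where "F n x = (U ^^ n) (f n x)" for n x
  \<comment> \<open>Tested against \<open>N\<close>, applying \<open>U\<^sup>j\<close> undoes \<open>j\<close> steps of the iteration.\<close>
  have shift: "inner ((U ^^ j) (f (n + j) x)) y = inner (f n x) y" if "y \<in> N" for n j x y
    using that
  proof (induction j arbitrary: n y)
    case (Suc j)
    have "inner ((U ^^ Suc j) (f (n + Suc j) x)) y = inner ((U ^^ j) (f (Suc n + j) x)) (inv U y)"
      by (simp add: unitary_inner_left[OF U])
    also have "\<dots> = inner (f (Suc n) x) (inv U y)" by (rule Suc.IH[OF N(3)[OF Suc.prems]])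
    also have "\<dots> = inner (f n x) y"
      using f_U[OF Suc.prems] by (simp add: unitary_inner_left[OF U])
    finally show ?case .
  qed simp
  have dist: "(norm (F (n + j) x - F n x))\<^sup>2 = (norm (f (n + j) x))\<^sup>2 - (norm (f n x))\<^sup>2" for n j x
  proof -
    have "inner (F (n + j) x) (F n x) = inner (f n x) (f n x)"
      by (simp add: F_def funpow_add unitary_funpow_inner[OF U] shift fN)
    moreover have "inner (F i x) (F i x) = inner (f i x) (f i x)" for i
      by (simp add: F_def unitary_funpow_inner[OF U])
    ultimately show ?thesis
      by (simp add: power2_norm_eq_inner inner_diff inner_commute)
  qed
  have F_le: "norm (F n x) \<le> c * norm x" for n x
    using f_le by (simp add: F_def unitary_funpow_norm[OF U])
  have F_lin: "bounded_clinear (F n)" for n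
    unfolding F_def
    by (intro bounded_clinear_compose[OF bounded_clinear_funpow[OF unitary_clinear[OF U]] f_lin])
  have "Cauchy (\<lambda>n. F n x)" for x
  proof -
    define r where "r n = (norm (f n x))\<^sup>2" for n
    have mono: "r n \<le> r (n + j)" for n j
      using dist[of n j x] zero_le_power2[of "norm (F (n + j) x - F n x)"] unfolding r_def by linarith
    have "incseq r" using mono[of _ 1] by (intro incseq_SucI) simp
    moreover have "r n \<le> (c * norm x)\<^sup>2" for n
      unfolding r_def by (rule power_mono[OF f_le]) simp
    ultimately have "convergent r"
      by (metis incseq_convergent convergent_def)
    then have r: "Cauchy r" by (rule convergent_Cauchy)
    have sq: "(norm (F m x - F n x))\<^sup>2 \<le> \<bar>r m - r n\<bar>" for m n
    proof (cases "n \<le> m")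
      case True
      then show ?thesis using dist[of n "m - n" x] by (simp add: r_def)
    next
      case False
      then show ?thesis using dist[of m "n - m" x] by (simp add: r_def norm_minus_commute)
    qed
    show ?thesis
    proof (rule CauchyI)
      fix e :: real assume e: "0 < e"
      then have "0 < e\<^sup>2" by simp
      from CauchyD[OF r this] obtain n0 where n0: "\<And>m n. m \<ge> n0 \<Longrightarrow> n \<ge> n0 \<Longrightarrow> \<bar>r m - r n\<bar> < e\<^sup>2"
        by auto
      show "\<exists>n0. \<forall>m\<ge>n0. \<forall>n\<ge>n0. norm (F m x - F n x) < e"
      proof (intro exI[of _ n0] allI impI)
        fix m n assume "n0 \<le> m" "n0 \<le> n"
        then have "(norm (F m x - F n x))\<^sup>2 < e\<^sup>2" using sq[of m n] n0[of m n] by simp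
        then show "norm (F m x - F n x) < e" using e by (simp add: power2_less_imp_less)
      qed
    qed
  qed
  then have conv: "convergent (\<lambda>n. F n x)" for x by (rule Cauchy_convergent)
  define S where "S x = lim (\<lambda>n. F n x)" for x
  have S: "(\<lambda>n. F n x) \<longlonglongrightarrow> S x" for x
    unfolding S_def using conv by (simp add: convergent_LIMSEQ_iff)
  show ?thesis
  proof (rule that)
    show "bounded_clinear S" "norm (S x) \<le> c * norm x" for x
      by (rule bounded_clinear_limit[OF F_lin F_le S])+
    show "U (S k) = S (W k)" if k: "k \<in> M" for k
    proof (rule LIMSEQ_unique)
      show "(\<lambda>n. U (F n k)) \<longlonglongrightarrow> U (S k)"
        by (rule bounded_linear.tendsto[OF bounded_clinear_bounded_linear[OF unitary_clinear[OF U]] S])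
      show "(\<lambda>n. U (F n k)) \<longlonglongrightarrow> S (W k)"
        using LIMSEQ_Suc[OF S[of "W k"]] by (simp add: F_def f_W[OF k])
    qed
    show "inner (S x) y = inner (H\<^sub>0 x) y" if y: "y \<in> N" for x y
    proof (rule LIMSEQ_unique)
      show "(\<lambda>n. inner (F n x) y) \<longlonglongrightarrow> inner (S x) y" by (intro tendsto_inner S tendsto_const)
      show "(\<lambda>n. inner (F n x) y) \<longlonglongrightarrow> inner (H\<^sub>0 x) y"
        using shift[OF y, of _ 0 x] by (simp add: F_def f_0)
    qed
  qed
qed

section \<open>Commutant lifting\<close>

lemma funpow_mem: "(\<And>x. x \<in> M \<Longrightarrow> f x \<in> M) \<Longrightarrow> x \<in> M \<Longrightarrow> (f ^^ n) x \<in> M"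
  by (induction n) auto

text \<open>An intertwiner defined on the whole space must satisfy \<open>S = U\<^sup>-\<^sup>n S W\<^sup>n\<close>. On a vector that
  \<open>n\<close> applications of \<open>W\<close> bring into \<open>M\<close> the right-hand side, formed with \<open>S\<^sub>0\<close>, is constant
  from \<open>n\<close> on; uniform boundedness carries the convergence over from this dense set to all
  vectors.\<close>

lemma extend_intertwiner:
  fixes U :: "'l::chilbert_space \<Rightarrow> 'l" and W :: "'k::complex_inner \<Rightarrow> 'k" and S\<^sub>0 :: "'k \<Rightarrow> 'l"
  assumes U: "unitary U" and W: "unitary W"
    and WM: "\<And>k. k \<in> M \<Longrightarrow> W k \<in> M"
    and dense: "closure {x. \<exists>n. (W ^^ n) x \<in> M} = UNIV"
    and S\<^sub>0: "bounded_clinear S\<^sub>0" "\<And>x. norm (S\<^sub>0 x) \<le> c * norm x"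
    and c: "0 \<le> c"
    and intertwine: "\<And>k. k \<in> M \<Longrightarrow> U (S\<^sub>0 k) = S\<^sub>0 (W k)"
  obtains S where "bounded_clinear S" "\<And>x. norm (S x) \<le> c * norm x"
    "\<And>x. U (S x) = S (W x)" "\<And>k. k \<in> M \<Longrightarrow> S k = S\<^sub>0 k"
proof -
  define V where "V = inv U"
  have V: "unitary V" unfolding V_def by (rule unitary_inv[OF U])
  define F where "F n x = (V ^^ n) (S\<^sub>0 ((W ^^ n) x))" for n x
  have F_lin: "bounded_clinear (F n)" for n
    unfolding F_def
    by (intro bounded_clinear_compose[OF bounded_clinear_funpow[OF unitary_clinear[OF V]]]
        bounded_clinear_compose[OF S\<^sub>0(1)] bounded_clinear_funpow[OF unitary_clinear[OF W]])
  have F_le: "norm (F n x) \<le> c * norm x" for n x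
    using S\<^sub>0(2)[of "(W ^^ n) x"] by (simp add: F_def unitary_funpow_norm[OF V] unitary_funpow_norm[OF W])
  have F_const: "F (n + j) x = F n x" if x: "(W ^^ n) x \<in> M" for n j x
  proof (induction j)
    case (Suc j)
    have "(W ^^ (n + j)) x \<in> M"
      using funpow_mem[of M W, OF WM x, of j] by (simp add: funpow_add add.commute)
    then have "S\<^sub>0 (W ((W ^^ (n + j)) x)) = U (S\<^sub>0 ((W ^^ (n + j)) x))" by (simp add: intertwine)
    then have "F (n + Suc j) x = F (n + j) x"
      by (simp add: F_def funpow_swap1 V_def unitary_inv_apply[OF U])
    with Suc.IH show ?case by simp
  qed simp
  have "Cauchy (\<lambda>n. F n x)" for x
  proof (rule CauchyI)
    fix e :: real assume e: "0 < e"
    \<comment> \<open>Replacing \<open>x\<close> by a vector at distance \<open>d\<close> costs \<open>c * d\<close> for each of the two terms compared;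
      the summand \<open>1\<close> makes the total strictly less than \<open>e\<close>.\<close>
    define d where "d = e / (2 * c + 1)"
    have d: "0 < d" unfolding d_def using e c by simp
    have "(2 * c + 1) * d = e" unfolding d_def using c by simp
    then have e_eq: "c * d + c * d + d = e" by (simp add: algebra_simps)
    have "x \<in> closure {x. \<exists>n. (W ^^ n) x \<in> M}" using dense by simp
    then obtain y n0 where y: "(W ^^ n0) y \<in> M" "dist y x < d"
      unfolding closure_approachable using d by blast
    have near: "norm (F n x - F n y) \<le> c * d" for n
    proof -
      have "norm (F n x - F n y) \<le> c * norm (x - y)"
        using F_le[of n "x - y"] by (simp add: bounded_clinear_diff[OF F_lin])
      also have "\<dots> \<le> c * d"
        using y(2) c by (intro mult_left_mono) (simp_all add: dist_norm norm_minus_commute)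
      finally show ?thesis .
    qed
    show "\<exists>n0. \<forall>m\<ge>n0. \<forall>n\<ge>n0. norm (F m x - F n x) < e"
    proof (intro exI[of _ n0] allI impI)
      fix m n assume "n0 \<le> m" "n0 \<le> n"
      then have "F m y = F n y"
        using F_const[OF y(1), of "m - n0"] F_const[OF y(1), of "n - n0"] by simp
      then have "F m x - F n x = (F m x - F m y) - (F n x - F n y)" by simp
      also have "norm \<dots> \<le> c * d + c * d"
        by (rule order_trans[OF norm_triangle_ineq4 add_mono[OF near near]])
      also have "c * d + c * d < e"
        using e_eq d by simp
      finally show "norm (F m x - F n x) < e" .
    qed
  qed
  then have conv: "convergent (\<lambda>n. F n x)" for x by (rule Cauchy_convergent)
  define S where "S x = lim (\<lambda>n. F n x)" for x
  have S: "(\<lambda>n. F n x) \<longlonglongrightarrow> S x" for x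
    unfolding S_def using conv by (simp add: convergent_LIMSEQ_iff)
  show ?thesis
  proof (rule that)
    show "bounded_clinear S" "norm (S x) \<le> c * norm x" for x
      by (rule bounded_clinear_limit[OF F_lin F_le S])+
    have "F (Suc n) x = V (F n (W x))" for n x
      by (simp only: F_def funpow.simps(2)[of n V] funpow_Suc_right[of n W] o_apply)
    then have shift: "U (F (Suc n) x) = F n (W x)" for n x
      by (simp add: V_def unitary_apply_inv[OF U])
    show "U (S x) = S (W x)" for x
    proof (rule LIMSEQ_unique)
      show "(\<lambda>n. U (F (Suc n) x)) \<longlonglongrightarrow> U (S x)"
        by (rule bounded_linear.tendsto[OF bounded_clinear_bounded_linear[OF unitary_clinear[OF U]]
              LIMSEQ_Suc[OF S]])
      show "(\<lambda>n. U (F (Suc n) x)) \<longlonglongrightarrow> S (W x)"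
        unfolding shift by (rule S)
    qed
    show "S k = S\<^sub>0 k" if "k \<in> M" for k
    proof (rule LIMSEQ_unique[OF S])
      show "(\<lambda>n. F n k) \<longlonglongrightarrow> S\<^sub>0 k"
        using F_const[of 0 k] that by (simp add: F_def)
    qed
  qed
qed

text \<open>The commutant lifting theorem for two contractions and their unitary dilations. The subspaces
  \<open>M\<close> and \<open>N\<close> are defined by the identities that the argument uses, which makes them
  as large as possible; that \<open>M\<close> contains the forward orbit under \<open>W\<close> of the range of \<open>J\<close>, and
  \<open>N\<close> the range of \<open>J'\<close>, is the dilation property.\<close>

theorem intertwining_lifting:
  fixes A :: "'g::chilbert_space \<Rightarrow> 'g" and B :: "'h::chilbert_space \<Rightarrow> 'h"
    and J' :: "'g \<Rightarrow> 'l::chilbert_space" and J :: "'h \<Rightarrow> 'k::chilbert_space"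
  assumes dil': "minimal_unitary_dilation J' A U" and dil: "minimal_unitary_dilation J B W"
    and X: "bounded_clinear X" and AX: "\<And>h. A (X h) = X (B h)"
  obtains S where "bounded_clinear S" "onorm S = onorm X" "\<And>x. U (S x) = S (W x)"
    "\<And>n h. orth_proj (range J') (S ((W ^^ n) (J h))) = J' (X ((B ^^ n) h))"
proof -
  have J': "isometric_embedding J'" and U: "unitary U"
    and A_proj: "\<And>n h. J' ((A ^^ n) h) = orth_proj (range J') ((U ^^ n) (J' h))"
    using dil' by (auto simp: minimal_unitary_dilation_def)
  have J: "isometric_embedding J" and W: "unitary W"
    and B_proj: "\<And>n h. J ((B ^^ n) h) = orth_proj (range J) ((W ^^ n) (J h))"
    and dense: "closure (cspan {op_powi W n (J h) | n h. True}) = UNIV"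
    using dil by (auto simp: minimal_unitary_dilation_def)
  obtain R' where R': "bounded_clinear R'" "\<And>h. R' (J' h) = h" "\<And>x. norm (R' x) \<le> norm x"
    "\<And>x h. inner (R' x) h = inner x (J' h)"
    using isometric_embedding_adjoint[OF J'] by blast
  obtain R where R: "bounded_clinear R" "\<And>h. R (J h) = h" "\<And>x. norm (R x) \<le> norm x"
    "\<And>x h. inner (R x) h = inner x (J h)"
    using isometric_embedding_adjoint[OF J] by blast
  have A: "R' ((U ^^ n) (J' h)) = (A ^^ n) h" for n h
    using A_proj[of n h] R'(2) by (metis orth_proj_range[OF J' R'(4)])
  have B: "R ((W ^^ n) (J h)) = (B ^^ n) h" for n h
    using B_proj[of n h] R(2) by (metis orth_proj_range[OF J R(4)])
  note J'_lin = isometric_embedding_clinear[OF J'] and J_lin = isometric_embedding_clinear[OF J]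
  note U_lin = unitary_clinear[OF U] and W_lin = unitary_clinear[OF W]
  have "(\<lambda>h. R (W (J h))) = B" using B[of 1] by auto
  with bounded_clinear_compose[OF R(1) bounded_clinear_compose[OF W_lin J_lin]]
  have B_lin: "bounded_clinear B" by simp
  have "(\<lambda>h. R' (U (J' h))) = A" using A[of 1] by auto
  with bounded_clinear_compose[OF R'(1) bounded_clinear_compose[OF U_lin J'_lin]]
  have A_lin: "bounded_clinear A" by simp
  define c where "c = onorm X"
  have X_le: "norm (X h) \<le> c * norm h" for h
    unfolding c_def by (rule onorm[OF bounded_clinear_bounded_linear[OF X]])
  have c: "0 \<le> c"
    unfolding c_def by (rule onorm_pos_le[OF bounded_clinear_bounded_linear[OF X]])
  define M where "M = {k. \<forall>j. R ((W ^^ Suc j) k) = B (R ((W ^^ j) k))}"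
  define N where "N = {y. \<forall>j h. inner ((U ^^ Suc j) (J' h)) y = inner ((U ^^ j) (J' (A h))) y}"
  note W_pow = bounded_clinear_funpow[OF W_lin] and U_pow = bounded_clinear_funpow[OF U_lin]
  have M: "cvec.subspace M"
    unfolding cvec.subspace_def M_def
    by (simp add: bounded_clinear_zero bounded_clinear_add bounded_clinear_scaleC R(1) B_lin W_lin
        W_pow)
  have WM: "W k \<in> M" if "k \<in> M" for k
    unfolding M_def mem_Collect_eq
  proof
    fix j
    have "R ((W ^^ Suc (Suc j)) k) = B (R ((W ^^ Suc j) k))"
      using that unfolding M_def by blast
    then show "R ((W ^^ Suc j) (W k)) = B (R ((W ^^ j) (W k)))"
      by (simp only: funpow_Suc_right o_apply)
  qed
  have WJ: "(W ^^ n) (J h) \<in> M" for n h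
  proof (rule funpow_mem[of M W, OF WM])
    show "J h \<in> M" unfolding M_def mem_Collect_eq B by simp
  qed
  have N_sub: "cvec.subspace N"
    unfolding cvec.subspace_def
  proof (intro conjI ballI allI)
    fix a y assume y: "y \<in> N"
    show "a *\<^sub>C y \<in> N"
      unfolding N_def mem_Collect_eq
    proof (intro allI)
      fix j h
      have "inner ((U ^^ Suc j) (J' (cnj a *\<^sub>C h))) y = inner ((U ^^ j) (J' (A (cnj a *\<^sub>C h)))) y"
        using y unfolding N_def by blast
      then show "inner ((U ^^ Suc j) (J' h)) (a *\<^sub>C y) = inner ((U ^^ j) (J' (A h))) (a *\<^sub>C y)"
        by (simp add: inner_scaleC_right bounded_clinear_scaleC J'_lin A_lin U_lin U_pow)
    qed
  qed (simp_all add: N_def inner_add_right)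
  have N_closed: "closed N"
    unfolding N_def by (intro closed_Collect_all closed_Collect_eq continuous_intros)
  have N_inv: "inv U y \<in> N" if "y \<in> N" for y
    unfolding N_def mem_Collect_eq
  proof (intro allI)
    fix j h
    have "inner ((U ^^ Suc (Suc j)) (J' h)) y = inner ((U ^^ Suc j) (J' (A h))) y"
      using that unfolding N_def by blast
    then show "inner ((U ^^ Suc j) (J' h)) (inv U y) = inner ((U ^^ j) (J' (A h))) (inv U y)"
      by (simp add: unitary_inner_left[OF U])
  qed
  have J'N: "J' g \<in> N" for g
    unfolding N_def mem_Collect_eq R'(4)[symmetric] A by (simp add: funpow_swap1)
  define H\<^sub>0 where "H\<^sub>0 x = J' (X (R x))" for x
  have H\<^sub>0_lin: "bounded_clinear H\<^sub>0"
    unfolding H\<^sub>0_def by (intro bounded_clinear_compose[OF J'_lin] bounded_clinear_compose[OF X] R(1))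
  have H\<^sub>0_le: "norm (H\<^sub>0 x) \<le> c * norm x" for x
    unfolding H\<^sub>0_def isometric_embedding_norm[OF J']
    by (rule order_trans[OF X_le mult_left_mono[OF R(3) c]])
  have H\<^sub>0_N: "H\<^sub>0 x \<in> N" for x unfolding H\<^sub>0_def by (rule J'N)
  have compat: "inner (U (H\<^sub>0 k)) y = inner (H\<^sub>0 (W k)) y" if "k \<in> M" "y \<in> N" for k y
  proof -
    have "inner ((U ^^ Suc 0) (J' (X (R k)))) y = inner ((U ^^ 0) (J' (A (X (R k))))) y"
      using that(2) unfolding N_def by blast
    moreover have "R ((W ^^ Suc 0) k) = B (R ((W ^^ 0) k))"
      using that(1) unfolding M_def by blast
    ultimately show ?thesis by (simp add: H\<^sub>0_def AX)
  qed
  obtain S\<^sub>0 where S\<^sub>0: "bounded_clinear S\<^sub>0" "\<And>x. norm (S\<^sub>0 x) \<le> c * norm x"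
    "\<And>k. k \<in> M \<Longrightarrow> U (S\<^sub>0 k) = S\<^sub>0 (W k)"
    "\<And>x y. y \<in> N \<Longrightarrow> inner (S\<^sub>0 x) y = inner (H\<^sub>0 x) y"
    using lifting_half[OF U W M N_sub N_closed N_inv H\<^sub>0_lin H\<^sub>0_le H\<^sub>0_N compat] by blast
  \<comment> \<open>The set \<open>D\<close> contains \<open>W\<^sup>n J h\<close> for all integers \<open>n\<close>, so minimality makes it dense.\<close>
  define D where "D = {x. \<exists>n. (W ^^ n) x \<in> M}"
  have W_mono: "(W ^^ (n + j)) x \<in> M" if "(W ^^ n) x \<in> M" for n j x
    using funpow_mem[of M W, OF WM that, of j] by (simp add: funpow_add add.commute[of n])
  have "cvec.subspace D"
    unfolding cvec.subspace_def
  proof (intro conjI ballI allI)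
    show "0 \<in> D" unfolding D_def using cvec.subspace_0[OF M] by (auto intro!: exI[of _ 0])
    show "x + y \<in> D" if xy: "x \<in> D" "y \<in> D" for x y
    proof -
      obtain m n where "(W ^^ m) x \<in> M" "(W ^^ n) y \<in> M" using xy by (auto simp: D_def)
      then have "(W ^^ (m + n)) (x + y) \<in> M"
        using W_mono[of m x n] W_mono[of n y m] cvec.subspace_add[OF M]
        by (simp add: bounded_clinear_add[OF W_pow] add.commute)
      then show ?thesis by (auto simp: D_def)
    qed
    show "a *\<^sub>C x \<in> D" if "x \<in> D" for a x
      using that cvec.subspace_scale[OF M] by (auto simp: D_def bounded_clinear_scaleC[OF W_pow])
  qed
  moreover have "op_powi W n (J h) \<in> D" for n h
  proof (cases "n \<ge> 0")
    case True
    then show ?thesis using WJ by (auto simp: op_powi_def D_def intro!: exI[of _ 0])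
  next
    case False
    have "(W ^^ m) ((inv W ^^ m) x) = x" for m x
    proof (induction m)
      case (Suc m)
      then show ?case by (simp add: funpow_swap1[of W] unitary_apply_inv[OF W])
    qed simp
    then have "(W ^^ nat (- n)) (op_powi W n (J h)) \<in> M"
      using False WJ[of 0 h] by (simp add: op_powi_def)
    then show ?thesis by (auto simp: D_def)
  qed
  ultimately have "cspan {op_powi W n (J h) | n h. True} \<subseteq> D"
    by (intro cvec.span_minimal) auto
  then have "closure D = UNIV" using dense closure_mono by blast
  then obtain S where S: "bounded_clinear S" "\<And>x. norm (S x) \<le> c * norm x"
    "\<And>x. U (S x) = S (W x)" "\<And>k. k \<in> M \<Longrightarrow> S k = S\<^sub>0 k"
    using extend_intertwiner[OF U W WM _ S\<^sub>0(1,2) c S\<^sub>0(3)] unfolding D_def by blast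
  have "R' (S\<^sub>0 x) = X (R x)" for x
  proof -
    have "inner (R' (S\<^sub>0 x)) h = inner (X (R x)) h" for h
      using S\<^sub>0(4)[OF J'N] by (simp add: R'(4) H\<^sub>0_def isometric_embedding_inner[OF J'])
    then show ?thesis by (rule vector_eq_rdot[THEN iffD1, OF allI])
  qed
  then have R'S: "R' (S ((W ^^ n) (J h))) = X ((B ^^ n) h)" for n h
    using S(4)[OF WJ] by (simp add: B)
  show ?thesis
  proof (rule that[OF S(1) _ S(3)])
    show "orth_proj (range J') (S ((W ^^ n) (J h))) = J' (X ((B ^^ n) h))" for n h
      by (simp add: orth_proj_range[OF J' R'(4)] R'S)
    show "onorm S = onorm X"
    proof (rule antisym)
      show "onorm S \<le> onorm X"
        using S(2) c by (intro onorm_bound) (simp_all add: c_def)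
      have "norm (X h) \<le> onorm S * norm h" for h
      proof -
        have "norm (X h) \<le> norm (S (J h))"
          using R'(3)[of "S (J h)"] R'S[of 0 h] by simp
        also have "\<dots> \<le> onorm S * norm (J h)"
          by (rule onorm[OF bounded_clinear_bounded_linear[OF S(1)]])
        finally show ?thesis by (simp add: isometric_embedding_norm[OF J])
      qed
      then show "onorm X \<le> onorm S"
        by (intro onorm_bound onorm_pos_le bounded_clinear_bounded_linear[OF S(1)])
    qed
  qed
qed

lemma funpow_scaleC:
  fixes f :: "'a::complex_inner \<Rightarrow> 'a"
  assumes "bounded_clinear f"
  shows "((\<lambda>x. q *\<^sub>C f x) ^^ n) x = q ^ n *\<^sub>C (f ^^ n) x"
  by (induction n) (simp_all add: bounded_clinear_scaleC[OF assms] mult.commute)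

theorem theorem4p6:
  fixes T\<^sub>1 T\<^sub>2 :: "'h::chilbert_space \<Rightarrow> 'h"
    and q :: complex
    and J' :: "'h \<Rightarrow> 'l::chilbert_space"
    and U :: "'l \<Rightarrow> 'l"
    and J :: "'h \<Rightarrow> 'k::chilbert_space"
    and U\<^sub>q :: "'k \<Rightarrow> 'k"
  assumes "contraction T\<^sub>1"
    and "T\<^sub>1 \<noteq> (\<lambda>h. 0)"
    and "bounded_clinear T\<^sub>2"
    and "\<forall>h. T\<^sub>1 (T\<^sub>2 h) = q *\<^sub>C T\<^sub>2 (T\<^sub>1 h)"
    and "0 < cmod q"
    and "cmod q \<le> 1 / onorm T\<^sub>1"
    and "minimal_unitary_dilation J' T\<^sub>1 U"
    and "bounded_clinear U\<^sub>q"
    and "minimal_unitary_dilation J (\<lambda>h. q *\<^sub>C T\<^sub>1 h) (\<lambda>x. q *\<^sub>C U\<^sub>q x)"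
  shows "\<exists>S :: 'k \<Rightarrow> 'l. bounded_clinear S \<and>
    onorm S = onorm T\<^sub>2 \<and>
    (\<forall>x. U (S x) = q *\<^sub>C S (U\<^sub>q x)) \<and>
    (\<forall>n h. J' ((T\<^sub>1 ^^ n) (T\<^sub>2 h)) = orth_proj (range J') ((U ^^ n) (S (J h))) \<and>
           J' (T\<^sub>2 ((T\<^sub>1 ^^ n) h)) = orth_proj (range J') (S ((U\<^sub>q ^^ n) (J h))))"
proof -
  let ?B = "\<lambda>h. q *\<^sub>C T\<^sub>1 h" and ?W = "\<lambda>x. q *\<^sub>C U\<^sub>q x"
  have T\<^sub>1: "bounded_clinear T\<^sub>1" using assms(1) by (simp add: contraction_def)
  have q: "q \<noteq> 0" using assms(5) by auto
  note T\<^sub>2 = bounded_clinear_scaleC[OF assms(3)]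
  have intertwine: "T\<^sub>1 (T\<^sub>2 h) = T\<^sub>2 (?B h)" for h using assms(4) by (simp add: T\<^sub>2)
  obtain S where S: "bounded_clinear S" "onorm S = onorm T\<^sub>2" "\<And>x. U (S x) = S (?W x)"
    and proj: "\<And>n h. orth_proj (range J') (S ((?W ^^ n) (J h))) = J' (T\<^sub>2 ((?B ^^ n) h))"
    using intertwining_lifting[OF assms(7,9,3) intertwine] by blast
  have J': "isometric_embedding J'"
    using assms(7) by (simp add: minimal_unitary_dilation_def)
  note J'_lin = isometric_embedding_clinear[OF J']
  obtain R' where R': "bounded_clinear R'" "\<And>h. R' (J' h) = h" "\<And>x. norm (R' x) \<le> norm x"
    "\<And>x h. inner (R' x) h = inner x (J' h)"
    using isometric_embedding_adjoint[OF J'] by blast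
  have proj_scale: "orth_proj (range J') (a *\<^sub>C x) = a *\<^sub>C orth_proj (range J') x" for a x
    by (simp add: orth_proj_range[OF J' R'(4)] bounded_clinear_scaleC J'_lin R'(1))
  \<comment> \<open>Both identities below compare with the same projection, that of \<open>S\<close> at the \<open>n\<close>-th power of \<open>?W\<close>.\<close>
  have T_pow: "(T\<^sub>1 ^^ n) (T\<^sub>2 h) = T\<^sub>2 ((?B ^^ n) h)" for n h
    by (induction n) (simp_all add: intertwine)
  have U_pow: "(U ^^ n) (S x) = S ((?W ^^ n) x)" for n x
    by (induction n) (simp_all add: S(3))
  have "J' (T\<^sub>2 ((T\<^sub>1 ^^ n) h)) = orth_proj (range J') (S ((U\<^sub>q ^^ n) (J h)))" for n h
  proof -
    have "q ^ n *\<^sub>C J' (T\<^sub>2 ((T\<^sub>1 ^^ n) h)) = q ^ n *\<^sub>C orth_proj (range J') (S ((U\<^sub>q ^^ n) (J h)))"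
      using proj[of n h]
      by (simp add: funpow_scaleC[OF T\<^sub>1] funpow_scaleC[OF assms(8)] T\<^sub>2 proj_scale
          bounded_clinear_scaleC[OF S(1)] bounded_clinear_scaleC[OF J'_lin])
    then have "inverse (q ^ n) *\<^sub>C q ^ n *\<^sub>C J' (T\<^sub>2 ((T\<^sub>1 ^^ n) h)) =
        inverse (q ^ n) *\<^sub>C q ^ n *\<^sub>C orth_proj (range J') (S ((U\<^sub>q ^^ n) (J h)))" by simp
    then show ?thesis using q by simp
  qed
  moreover have "J' ((T\<^sub>1 ^^ n) (T\<^sub>2 h)) = orth_proj (range J') ((U ^^ n) (S (J h)))" for n h
    by (simp add: T_pow U_pow proj)
  moreover have "U (S x) = q *\<^sub>C S (U\<^sub>q x)" for x
    by (simp add: S(3) bounded_clinear_scaleC[OF S(1)])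
  ultimately show ?thesis using S(1,2) by blast
qed

end
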